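(* Let $V=\coprod_{n\ge t}V_{(n)}$ (with $t\in\mathbb{Z}$) be a lower truncated $\mathbb{Z}$-graded vertex algebra. Then for $n\ge 2$, $$C_n(V)\subset\coprod_{k\ge 2t+n-1}V_{(k)}.$$ Furthermore, for $n\ge 2$, $$E_m(V)\subset\coprod_{k\ge 2t+n-1}V_{(k)}\quad\text{whenever } m\ge (n-2)2^{n-2},$$ and $$\bigcap_{n\ge 0}E_n(V)=\bigcap_{n\ge 2}C_n(V)=0.$$
   Context: Vector spaces are over $\mathbb{C}$. For a vertex algebra $V$ write $Y(u,x)=\sum_{n\in\mathbb{Z}}u_nx^{-n-1}$. A $\mathbb{Z}$-graded vertex algebra is a vertex algebra with a grading $V=\coprod_{n\in\mathbb{Z}}V_{(n)}$ such that $\mathbf{1}\in V_{(0)}$ and $u_mV_{(n)}\subset V_{(n+k-m-1)}$ for $u\in V_{(k)}$, $k,m,n\in\mathbb{Z}$. It is lower truncated if $V_{(n)}=0$ for $n$ sufficiently small; $V=\coprod_{n\ge t}V_{(n)}$ means $V_{(n)}=0$ for $n<t$. For $n\in\mathbb{Z}$, $E_n(V)$ is the linear span of the vectors $u^{(1)}_{-1-k_1}\cdots u^{(r)}_{-1-k_r}v$ for $r\ge 1$, $u^{(1)},\dots,u^{(r)},v\in V$, $k_1,\dots,k_r\ge 0$ with $k_1+\cdots+k_r\ge n$. For $n\ge 2$, $C_n(V)$ is the linear span of the vectors $u_{-n}v$ for $u,v\in V$.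
   Formalization: The second claim is proved for m ≥ 1, which excludes only n = 2, m = 0: there E_0(V) = V, and V = ℂ in degree 0 with t = 0 is a counterexample (for t < 0 that instance is immediate from V = ∐_{k≥t} V_(k)). *)

theory Defs
  imports Complex_Main "HOL-Library.Groups_Big_Fun"
begin

text \<open>
  A vertex algebra on the complex vector space \<open>'v\<close> is given by its modes:
  \<open>mode u n v\<close> stands for \<open>u\<^sub>n v\<close>, where \<open>Y(u,x) = \<Sum>n. u\<^sub>n x\<^sup>-\<^sup>n\<^sup>-\<^sup>1\<close>. The axiom \<open>jacobi\<close> is the
  Jacobi identity
  \<open>x\<^sub>0\<^sup>-\<^sup>1\<delta>((x\<^sub>1-x\<^sub>2)/x\<^sub>0) Y(u,x\<^sub>1)Y(v,x\<^sub>2)w - x\<^sub>0\<^sup>-\<^sup>1\<delta>((x\<^sub>2-x\<^sub>1)/(-x\<^sub>0)) Y(v,x\<^sub>2)Y(u,x\<^sub>1)w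
    = x\<^sub>2\<^sup>-\<^sup>1\<delta>((x\<^sub>1-x\<^sub>0)/x\<^sub>2) Y(Y(u,x\<^sub>0)v,x\<^sub>2)w\<close>,
  read off (with the sides exchanged) at \<open>x\<^sub>0\<^sup>-\<^sup>l\<^sup>-\<^sup>1 x\<^sub>1\<^sup>-\<^sup>m\<^sup>-\<^sup>1 x\<^sub>2\<^sup>-\<^sup>n\<^sup>-\<^sup>1\<close>. By \<open>truncation\<close> only finitely many
  terms are nonzero on each side, so that \<open>Sum_any\<close> (which is 0 on functions of
  infinite support) is the intended sum.
\<close>

locale vertex_algebra = vector_space scale
  for scale :: "complex \<Rightarrow> 'v::ab_group_add \<Rightarrow> 'v" +
  fixes mode :: "'v \<Rightarrow> int \<Rightarrow> 'v \<Rightarrow> 'v"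
    and vac :: 'v
  assumes linear_left: "Vector_Spaces.linear scale scale (\<lambda>u. mode u n v)"
    and linear_right: "Vector_Spaces.linear scale scale (mode u n)"
    and truncation: "\<exists>N. \<forall>n\<ge>N. mode u n v = 0"
    and vacuum: "mode vac n v = (if n = -1 then v else 0)"
    and creation: "n \<ge> 0 \<Longrightarrow> mode u n vac = 0" "mode u (-1) vac = u"
    and jacobi:
      "Sum_any (\<lambda>i::nat. scale (of_int m gchoose i)
         (mode (mode u (l + int i) v) (m + n - int i) w)) =
       Sum_any (\<lambda>i::nat. scale ((-1) ^ i * (of_int l gchoose i))
         (mode u (m + l - int i) (mode v (n + int i) w)
           - scale ((-1) powi l) (mode v (n + l - int i) (mode u (m + int i) w))))"
begin

definition E_space :: "int \<Rightarrow> 'v set" where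
  "E_space n = span {foldr (\<lambda>(u, k). mode u (-1 - int k)) uks v | uks v.
     uks \<noteq> [] \<and> int (\<Sum>(u, k)\<leftarrow>uks. k) \<ge> n}"

text \<open>Of interest only for \<open>n \<ge> 2\<close>.\<close>

definition C_space :: "int \<Rightarrow> 'v set" where
  "C_space n = span {mode u (-n) v | u v. True}"

end

locale graded_vertex_algebra = vertex_algebra scale mode vac
  for scale :: "complex \<Rightarrow> 'v::ab_group_add \<Rightarrow> 'v" and mode vac +
  fixes grade :: "int \<Rightarrow> 'v set"
  assumes subspace_grade: "subspace (grade n)"
    and direct_sum:
      "\<exists>!f. (\<forall>n. f n \<in> grade n) \<and> finite {n. f n \<noteq> 0} \<and> v = Sum_any f"
    and vac_grade: "vac \<in> grade 0"
    and mode_grade: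
      "u \<in> grade k \<Longrightarrow> v \<in> grade n \<Longrightarrow> mode u m v \<in> grade (n + k - m - 1)"
begin

text \<open>The subspace \<open>\<Coprod>\<^bsub>k\<ge>N\<^esub> V\<^sub>(\<^sub>k\<^sub>)\<close> of \<open>V\<close>.\<close>

definition grade_ge :: "int \<Rightarrow> 'v set" where
  "grade_ge N = span (\<Union>k\<in>{N..}. grade k)"

end

end

theory Submission imports Defs begin

text \<open>
  For any vertex algebra, \<open>E\<^sub>m \<subseteq> C\<^sub>n\<close> once \<open>m \<ge> (n - 2) 2\<^bsup>n-2\<^esup>\<close>: modulo \<open>C\<^sub>N\<^sub>+\<^sub>1\<close> the operators
  \<open>u\<^sub>-\<^sub>1\<^sub>-\<^sub>k\<close> commute with \<open>v\<^sub>-\<^sub>N\<close>, and two operators with index \<open>-N\<close> compose into \<open>C\<^sub>N\<^sub>+\<^sub>1\<close>, so if every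
  product with \<open>2\<^bsup>N-2\<^esup>\<close> factors of positive \<open>k\<close> maps into \<open>C\<^sub>N\<close>, then one with twice as many
  maps into \<open>C\<^sub>N\<^sub>+\<^sub>1\<close>. The degree of \<open>u\<^sub>-\<^sub>n v\<close> is at least \<open>2t + n - 1\<close>, which tends to infinity with \<open>n\<close>.
\<close>

section \<open>Sums in subspaces, splitting of lists, a binomial coefficient\<close>

lemma (in module) subspace_Sum_any:
  assumes "subspace S" "\<And>i. f i \<in> S"
  shows "Sum_any f \<in> S"
  unfolding Sum_any.expand_set using assms by (intro subspace_sum)

text \<open>Isolates one term of a series modulo \<open>S\<close>. Finite support is essential:
  otherwise \<open>Sum_any\<close> is 0 and says nothing about the terms.\<close>

lemma (in module) subspace_Sum_any_component:
  assumes S: "subspace S" and fin: "finite {i. f i \<noteq> 0}"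
    and sum: "Sum_any f \<in> S" and rest: "\<And>i. i \<noteq> j \<Longrightarrow> f i \<in> S"
  shows "f j \<in> S"
proof -
  let ?A = "insert j {i. f i \<noteq> 0}"
  have "Sum_any f = sum f ?A"
    by (rule Sum_any.expand_superset) (use fin in auto)
  also have "\<dots> = f j + sum f (?A - {j})"
    by (rule sum.remove) (simp_all add: fin)
  finally have "f j = Sum_any f - sum f (?A - {j})"
    by (simp only: add_diff_cancel_right')
  moreover have "sum f (?A - {j}) \<in> S"
    using S by (rule subspace_sum) (simp add: rest)
  ultimately show ?thesis using subspace_diff[OF S sum] by (simp only:)
qed

lemma Sum_any_single: "(\<And>i. i \<noteq> j \<Longrightarrow> f i = 0) \<Longrightarrow> Sum_any f = f j"
  by (subst Sum_any.expand_superset[of "{j}"]) auto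

text \<open>Serves to cut an operator product in two, with a prescribed number of positive
  \<open>k\<close> in the left part.\<close>

lemma split_list_length_filter:
  assumes "a \<le> length (filter P xs)"
  obtains ys zs where "xs = ys @ zs" "length (filter P ys) = a"
    "length (filter P zs) = length (filter P xs) - a"
proof -
  have "\<exists>ys zs. xs = ys @ zs \<and> length (filter P ys) = a"
    using assms
  proof (induction xs rule: rev_induct)
    case (snoc x xs)
    show ?case
    proof (cases "a \<le> length (filter P xs)")
      case True
      then show ?thesis using snoc.IH by (metis append.assoc)
    next
      case False
      \<comment> \<open>The count grows by at most one per element, so it reaches \<open>a\<close>
        exactly here.\<close>
      then have "length (filter P (xs @ [x])) = a" using snoc.prems by (auto split: if_splits)
      then show ?thesis by (metis append_Nil2)
    qed
  qed simp
  then show ?thesis using that by fastforce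
qed

lemma gchoose_minus_two: "(-2 gchoose i :: complex) = (-1) ^ i * of_nat (Suc i)"
proof -
  have "(-2 gchoose i :: complex) = (-1) ^ i * (of_nat (Suc i) gchoose i)"
    by (subst gbinomial_minus[of 2, simplified]) (simp add: add.commute)
  also have "(of_nat (Suc i) gchoose i :: complex) = of_nat (Suc i)"
    by (simp only: binomial_gbinomial[symmetric]) simp
  finally show ?thesis .
qed

section \<open>Formulas for modes from the Jacobi identity\<close>

context vertex_algebra
begin

abbreviation desc_prod :: "('v \<times> nat) list \<Rightarrow> 'v \<Rightarrow> 'v" where
  "desc_prod \<equiv> foldr (\<lambda>(u, k). mode u (-1 - int k))"

lemmas mode_linear_left = linear_left[unfolded Vector_Spaces.linear_iff]
  and mode_linear_right = linear_right[unfolded Vector_Spaces.linear_iff]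

lemma mode_add_left: "mode (u + u') n v = mode u n v + mode u' n v"
  and mode_add_right: "mode u n (v + v') = mode u n v + mode u n v'"
  and mode_scale_left: "mode (scale c u) n v = scale c (mode u n v)"
  and mode_scale_right: "mode u n (scale c v) = scale c (mode u n v)"
  using mode_linear_left mode_linear_right by auto

lemma mode_zero_left [simp]: "mode 0 n v = 0"
  using mode_scale_left[of 0 0 n v] by simp

lemma mode_zero_right [simp]: "mode u n 0 = 0"
  using mode_scale_right[of u n 0 0] by simp

lemma mode_diff_right: "mode u n (v - v') = mode u n v - mode u n v'"
  using mode_add_right[of u n "v - v'" v'] by (simp add: algebra_simps)

text \<open>This is \<open>jacobi\<close> with \<open>l = 0\<close>: the coefficients
  \<open>0 gchoose i\<close> leave only \<open>i = 0\<close> on its right side.\<close>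

lemma commutator:
  "mode u m (mode v n w) - mode v n (mode u m w) =
   Sum_any (\<lambda>i::nat. scale (of_int m gchoose i) (mode (mode u (int i) v) (m + n - int i) w))"
proof -
  let ?g = "\<lambda>i::nat. scale ((-1) ^ i * (of_int 0 gchoose i))
         (mode u (m + 0 - int i) (mode v (n + int i) w)
           - scale ((-1) powi 0) (mode v (n + 0 - int i) (mode u (m + int i) w)))"
  have "?g i = 0" if "i \<noteq> 0" for i
    using that by (cases i) (auto simp: gbinomial_0)
  then have "Sum_any ?g = ?g 0" by (rule Sum_any_single)
  with jacobi[of m u 0 v n w] show ?thesis by simp
qed

text \<open>This is \<open>jacobi\<close> with \<open>m = 0\<close> and \<open>l = -1\<close>: its
  left side keeps only \<open>i = 0\<close>, and all signs on its right side cancel.\<close>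

lemma associator:
  "mode (mode u (-1) v) n w =
   Sum_any (\<lambda>i::nat. mode u (-1 - int i) (mode v (n + int i) w)
     + mode v (n - 1 - int i) (mode u (int i) w))"
proof -
  let ?f = "\<lambda>i::nat. scale (of_int 0 gchoose i)
         (mode (mode u (-1 + int i) v) (0 + n - int i) w)"
  have "?f i = 0" if "i \<noteq> 0" for i
    using that by (cases i) (auto simp: gbinomial_0)
  then have "Sum_any ?f = ?f 0" by (rule Sum_any_single)
  moreover have "(-1) ^ i * (-1 gchoose i) = (1::complex)" for i
    by (simp add: gbinomial_minus[of 1, simplified] flip: power_mult_distrib binomial_gbinomial)
  ultimately show ?thesis using jacobi[of 0 u "-1" v n w]
    by (simp add: algebra_simps)
qed

text \<open>With D the translation operator, \<open>mode u (-2) vac\<close> is D u, and the rule is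
  (D u)_n = -n u_(n-1). It is \<open>jacobi\<close> with \<open>m = 0\<close>, \<open>l = -2\<close>
  and \<open>v = vac\<close>.\<close>

lemma mode_translate:
  assumes "N \<ge> 1"
  shows "mode (mode u (-2) vac) (-N) w = scale (of_int N) (mode u (-N - 1) w)"
proof -
  let ?f = "\<lambda>i::nat. scale (of_int 0 gchoose i)
         (mode (mode u (-2 + int i) vac) (0 + (-N) - int i) w)"
  let ?g = "\<lambda>i::nat. scale ((-1) ^ i * (of_int (-2) gchoose i))
         (mode u (0 + (-2) - int i) (mode vac (-N + int i) w)
           - scale ((-1) powi (-2)) (mode vac (-N + (-2) - int i) (mode u (0 + int i) w)))"
  have "?f i = 0" if "i \<noteq> 0" for i
    using that by (cases i) (auto simp: gbinomial_0)
  then have "Sum_any ?f = ?f 0" by (rule Sum_any_single)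
  \<comment> \<open>Only the mode of \<open>vac\<close> at -1 is nonzero: \<open>-N + i = -1\<close>
    singles out this \<open>i\<close>, and \<open>-N - 2 - i\<close> is always below -1.\<close>
  moreover have "?g i = 0" if "i \<noteq> nat (N - 1)" for i
    using that assms by (auto simp: vacuum)
  then have "Sum_any ?g = ?g (nat (N - 1))" by (rule Sum_any_single)
  moreover have "?g (nat (N - 1)) = scale (of_int N) (mode u (-N - 1) w)"
    using assms by (simp add: vacuum gchoose_minus_two minus_diff_commute flip: power_mult_distrib mult.assoc)
  ultimately show ?thesis using jacobi[of 0 u "-2" vac "-N" w] by simp
qed

section \<open>Stability of the spaces C_n under modes\<close>

lemma subspace_C_space: "subspace (C_space n)"
  unfolding C_space_def by (rule subspace_span)

lemmas C_space_add = subspace_add[OF subspace_C_space]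
  and C_space_diff = subspace_diff[OF subspace_C_space]
  and C_space_scale = subspace_scale[OF subspace_C_space]
  and C_space_zero = subspace_0[OF subspace_C_space]

text \<open>Translation reduces lower modes to index \<open>-N\<close>: u_(-M-1) is (D u)_(-M)
  divided by \<open>M\<close>. In particular the C_n decrease.\<close>

lemma mode_in_C_space:
  assumes "1 \<le> N" "N \<le> - m"
  shows "mode u m v \<in> C_space N"
proof -
  have "mode u (- M) v \<in> C_space N" if "N \<le> M" for M
    using that
  proof (induction M arbitrary: u rule: int_ge_induct)
    case base
    show ?case unfolding C_space_def by (rule span_base) auto
  next
    case (step M)
    have "mode u (-M - 1) v = scale (1 / of_int M) (mode (mode u (-2) vac) (-M) v)"
      using step.hyps assms by (subst mode_translate) auto
    then show ?case using step.IH by (simp add: C_space_scale)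
  qed
  from this[of "- m"] assms show ?thesis by simp
qed

lemma C_space_subset:
  assumes "subspace S" "\<And>u v. mode u (-n) v \<in> S"
  shows "C_space n \<subseteq> S"
  unfolding C_space_def using assms by (intro span_minimal) auto

lemma subspace_mode_left: "subspace S \<Longrightarrow> subspace {u. mode u n v \<in> S}"
  and subspace_mode_right: "subspace S \<Longrightarrow> subspace {v. mode u n v \<in> S}"
  by (auto simp: subspace_def mode_add_left mode_scale_left mode_add_right mode_scale_right)

text \<open>Every mode in the commutator formula has index
  \<open>m + n - i \<le> -N\<close>.\<close>

lemma commutator_in_C_space:
  assumes "1 \<le> N" "m + n \<le> - N"
  shows "mode u m (mode v n w) - mode v n (mode u m w) \<in> C_space N"
  unfolding commutator using assms
  by (intro subspace_Sum_any subspace_C_space C_space_scale mode_in_C_space) auto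

text \<open>Moving \<open>mode u m\<close> past a_(-N) costs a commutator of total index
  \<open>m - N\<close>, which is below \<open>-N\<close>.\<close>

lemma mode_C_space:
  assumes "1 \<le> N" "m < 0" "w \<in> C_space N"
  shows "mode u m w \<in> C_space N"
proof -
  have "C_space N \<subseteq> {w. mode u m w \<in> C_space N}"
  proof (intro C_space_subset subspace_mode_right subspace_C_space CollectI)
    fix a b
    have "mode u m (mode a (-N) b) - mode a (-N) (mode u m b) \<in> C_space N"
      using assms by (intro commutator_in_C_space) auto
    moreover have "mode a (-N) (mode u m b) \<in> C_space N"
      using assms by (intro mode_in_C_space) auto
    ultimately show "mode u m (mode a (-N) b) \<in> C_space N"
      using C_space_add by fastforce
  qed
  with assms show ?thesis by auto
qed

text \<open>In the expansion of \<open>(u\<^sub>-\<^sub>1 v)\<^sub>-\<^sub>2\<^sub>N\<^sub>+\<^sub>1 w\<close>, every term other than \<open>u\<^sub>-\<^sub>N v\<^sub>-\<^sub>N w\<close> has a factor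
  with index at most \<open>-N-1\<close>.\<close>

lemma mode_mode_in_C_space_Suc:
  assumes "N \<ge> 2"
  shows "mode u (-N) (mode v (-N) w) \<in> C_space (N + 1)"
proof -
  let ?f = "\<lambda>i::nat. mode u (-1 - int i) (mode v (1 - 2*N + int i) w)
     + mode v (1 - 2*N - 1 - int i) (mode u (int i) w)"
  \<comment> \<open>At this \<open>i\<close> both modes of the first summand have index
    \<open>-N\<close>.\<close>
  let ?j = "nat (N - 1)"
  obtain K where K: "\<And>n. n \<ge> K \<Longrightarrow> mode v n w = 0" using truncation by metis
  obtain L where L: "\<And>n. n \<ge> L \<Longrightarrow> mode u n w = 0" using truncation by metis
  have second: "mode v (1 - 2*N - 1 - int i) (mode u (int i) w) \<in> C_space (N + 1)" for i
    using assms by (intro mode_in_C_space) auto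
  have "?f ?j \<in> C_space (N + 1)"
  proof (rule subspace_Sum_any_component[OF subspace_C_space, where f = ?f])
    show "finite {i. ?f i \<noteq> 0}"
    proof (rule finite_subset)
      \<comment> \<open>Beyond this bound \<open>L\<close> kills the second summand and
        \<open>K\<close> the first.\<close>
      show "{i. ?f i \<noteq> 0} \<subseteq> {..<nat (max L (K + 2*N - 1))}"
      proof (rule subsetI, rule ccontr)
        fix i assume i: "i \<in> {i. ?f i \<noteq> 0}" "i \<notin> {..<nat (max L (K + 2*N - 1))}"
        then have "mode u (int i) w = 0" by (intro L) auto
        moreover have "1 - 2*N + int i \<ge> K" using i(2) by auto
        ultimately show False using K i(1) by auto
      qed
    qed simp
    \<comment> \<open>Here \<open>N \<ge> 2\<close> enters: it makes the index
      \<open>1 - 2*N\<close> at most \<open>-N - 1\<close>.\<close>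
    show "Sum_any ?f \<in> C_space (N + 1)"
      using assms by (subst associator[symmetric], intro mode_in_C_space) auto
    fix i assume "i \<noteq> ?j"
    then consider "int i \<ge> N" | "int i \<le> N - 2" using assms by linarith
    then have "mode u (-1 - int i) (mode v (1 - 2*N + int i) w) \<in> C_space (N + 1)"
    proof cases
      case 1
      then show ?thesis using assms by (intro mode_in_C_space) auto
    next
      case 2
      then show ?thesis using assms by (intro mode_C_space mode_in_C_space) auto
    qed
    then show "?f i \<in> C_space (N + 1)" using second by (rule C_space_add)
  qed
  from C_space_diff[OF this second[of ?j]] assms show ?thesis by simp
qed

section \<open>Products of modes and the doubling argument\<close>

lemma subspace_desc_prod: "subspace S \<Longrightarrow> subspace {v. desc_prod uks v \<in> S}"
proof (induction uks arbitrary: S)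
  case (Cons x uks)
  obtain u k where "x = (u, k)" by force
  then show ?case
    using Cons.IH[OF subspace_mode_right[OF Cons.prems, of u "-1 - int k"]] by simp
qed simp

lemma desc_prod_C_space:
  "1 \<le> N \<Longrightarrow> w \<in> C_space N \<Longrightarrow> desc_prod uks w \<in> C_space N"
  by (induction uks) (auto intro: mode_C_space)

text \<open>Each swap with a factor of index \<open>-1 - k\<close> has total index at most
  \<open>-N - 1\<close>, and the factors further left preserve C_(N+1).\<close>

lemma desc_prod_commutator:
  assumes "1 \<le> N"
  shows "desc_prod uks (mode a (-N) b) - mode a (-N) (desc_prod uks b) \<in> C_space (N + 1)"
proof (induction uks)
  case (Cons x uks)
  obtain u k where x: "x = (u, k)" by force
  let ?w = "desc_prod uks b" and ?m = "-1 - int k"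
  have "mode u ?m (desc_prod uks (mode a (-N) b) - mode a (-N) ?w) \<in> C_space (N + 1)"
    using Cons assms by (intro mode_C_space) auto
  moreover have "mode u ?m (mode a (-N) ?w) - mode a (-N) (mode u ?m ?w) \<in> C_space (N + 1)"
    using assms by (intro commutator_in_C_space) auto
  ultimately have "mode u ?m (desc_prod uks (mode a (-N) b) - mode a (-N) ?w)
      + (mode u ?m (mode a (-N) ?w) - mode a (-N) (mode u ?m ?w)) \<in> C_space (N + 1)"
    by (rule C_space_add)
  then show ?case by (simp add: x mode_diff_right)
qed (simp add: C_space_zero)

text \<open>On a generator a_(-N) b of C_N the mode a_(-N) is pulled out to the left. It then acts
  on an element of C_N, and two modes of index \<open>-N\<close> compose into C_(N+1).\<close>

lemma desc_prod_C_space_Suc: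
  assumes N: "2 \<le> N" and uks: "\<And>v. desc_prod uks v \<in> C_space N" and w: "w \<in> C_space N"
  shows "desc_prod uks w \<in> C_space (N + 1)"
proof -
  have "C_space N \<subseteq> {w. desc_prod uks w \<in> C_space (N + 1)}"
  proof (intro C_space_subset subspace_desc_prod subspace_C_space CollectI)
    fix a b
    have "C_space N \<subseteq> {w. mode a (-N) w \<in> C_space (N + 1)}"
      using mode_mode_in_C_space_Suc[OF N]
      by (intro C_space_subset subspace_mode_right subspace_C_space) auto
    then have "mode a (-N) (desc_prod uks b) \<in> C_space (N + 1)" using uks by auto
    moreover have "desc_prod uks (mode a (-N) b) - mode a (-N) (desc_prod uks b) \<in> C_space (N + 1)"
      using N by (intro desc_prod_commutator) auto
    ultimately show "desc_prod uks (mode a (-N) b) \<in> C_space (N + 1)"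
      using C_space_add by fastforce
  qed
  with w show ?thesis by auto
qed

text \<open>One deep factor suffices: it lands in C_N whatever its argument, and the factors on its
  left preserve C_N.\<close>

lemma desc_prod_in_C_space_member:
  assumes "(u, k) \<in> set uks" "1 \<le> N" "N \<le> int k + 1"
  shows "desc_prod uks v \<in> C_space N"
proof -
  obtain ys zs where "uks = ys @ (u, k) # zs" using assms(1) by (metis split_list)
  then show ?thesis
    using assms by (auto intro!: desc_prod_C_space mode_in_C_space)
qed

text \<open>One positive \<open>k\<close> gives an index of at most -2, hence C_2. For
  \<open>Suc j\<close> the list is cut into two parts that each map into C_(j+2), and their
  composite gains one.\<close>

lemma desc_prod_in_C_space_length:
  assumes "2 ^ j \<le> length (filter (\<lambda>(u, k). 0 < k) uks)"
  shows "desc_prod uks v \<in> C_space (int j + 2)"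
  using assms
proof (induction j arbitrary: uks v)
  case 0
  then have "filter (\<lambda>(u, k). 0 < k) uks \<noteq> []" by auto
  then obtain u k where "(u, k) \<in> set uks" "0 < k" by (auto simp: filter_empty_conv)
  then show ?case by (auto intro: desc_prod_in_C_space_member)
next
  case (Suc j)
  then have "2 ^ j \<le> length (filter (\<lambda>(u, k). 0 < k) uks)" by simp
  then obtain xs ys where uks: "uks = xs @ ys"
    and xs: "length (filter (\<lambda>(u, k). 0 < k) xs) = 2 ^ j"
    and ys: "length (filter (\<lambda>(u, k). 0 < k) ys) = length (filter (\<lambda>(u, k). 0 < k) uks) - 2 ^ j"
    by (rule split_list_length_filter)
  have "desc_prod xs v \<in> C_space (int j + 2)" for v
    using xs by (intro Suc.IH) simp
  moreover have "desc_prod ys v \<in> C_space (int j + 2)"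
    by (rule Suc.IH, subst ys) (use Suc.prems in simp)
  ultimately have "desc_prod xs (desc_prod ys v) \<in> C_space (int j + 2 + 1)"
    by (intro desc_prod_C_space_Suc) auto
  moreover have "int j + 2 + 1 = int (Suc j) + 2" by simp
  ultimately show ?case by (simp only: uks foldr_append o_apply)
qed

text \<open>Either some index is at most \<open>-n\<close>, or every \<open>k\<^sub>i\<close> is at most \<open>n - 2\<close> and hence at least
  \<open>2\<^bsup>n-2\<^esup>\<close> of them are positive.\<close>

lemma E_space_subset_C_space:
  assumes n: "n \<ge> 2" and m: "m \<ge> 1" "m \<ge> (n - 2) * 2 ^ nat (n - 2)"
  shows "E_space m \<subseteq> C_space n"
  unfolding E_space_def
proof (intro span_minimal subspace_C_space subsetI, clarify)
  fix uks :: "('v \<times> nat) list" and v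
  assume "m \<le> int (\<Sum>(u, k)\<leftarrow>uks. k)"
  define j where "j = nat (n - 2)"
  have nj: "n = int j + 2" using n by (simp add: j_def)
  let ?c = "length (filter (\<lambda>(u, k). 0 < k) uks)"
  show "desc_prod uks v \<in> C_space n"
  proof (cases "\<exists>(u, k)\<in>set uks. j < k")
    case True
    then show ?thesis using nj by (auto intro: desc_prod_in_C_space_member)
  next
    case False
    then have "(\<Sum>(u, k)\<leftarrow>uks. k) \<le> j * ?c"
      by (induction uks) (auto simp: not_less)
    with \<open>m \<le> _\<close> have le: "m \<le> int (j * ?c)" by linarith
    \<comment> \<open>If \<open>j = 0\<close>, that is \<open>n = 2\<close>, all \<open>k\<close>
      would vanish, against \<open>m \<ge> 1\<close>. Positivity lets \<open>j\<close> be cancelled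
      below.\<close>
    with m(1) have "j > 0" by (intro gr0I) auto
    from le m(2) have "int (j * 2 ^ j) \<le> int (j * ?c)" by (simp add: nj)
    then have "2 ^ j \<le> ?c" using \<open>j > 0\<close> by (simp only: of_nat_le_iff) simp
    then show ?thesis using desc_prod_in_C_space_length nj by simp
  qed
qed

end

section \<open>Degree estimates and separation by degree\<close>

context graded_vertex_algebra
begin

lemma subspace_grade_ge: "subspace (grade_ge N)"
  unfolding grade_ge_def by (rule subspace_span)

text \<open>Turns the span into families of homogeneous components, so that uniqueness in
  \<open>direct_sum\<close> applies.\<close>

lemma grade_ge_decomposition:
  assumes "v \<in> grade_ge N"
  obtains f where "\<And>n. f n \<in> grade n" "finite {n. f n \<noteq> 0}" "v = Sum_any f"
    "\<And>n. n < N \<Longrightarrow> f n = 0"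
proof -
  let ?P = "\<lambda>v f. (\<forall>n. f n \<in> grade n) \<and> finite {n. f n \<noteq> 0} \<and> v = Sum_any f
    \<and> (\<forall>n<N. f n = 0)"
  have "\<exists>f. ?P v f"
    using assms unfolding grade_ge_def
  proof (induction rule: span_induct_alt)
    case base
    show ?case by (rule exI[of _ "\<lambda>_. 0"]) (simp add: subspace_0 subspace_grade)
  next
    case (step c x y)
    then obtain k f where k: "k \<ge> N" "x \<in> grade k" and f: "?P y f" by auto
    let ?h = "\<lambda>n. if n = k then scale c x else 0"
    let ?g = "\<lambda>n. ?h n + f n"
    have fin: "finite {n. ?h n \<noteq> 0}" by (rule finite_subset[of _ "{k}"]) auto
    have "{n. ?g n \<noteq> 0} \<subseteq> {n. ?h n \<noteq> 0} \<union> {n. f n \<noteq> 0}" by auto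
    then have "finite {n. ?g n \<noteq> 0}" using fin f finite_subset by blast
    moreover have "Sum_any ?g = scale c x + y"
      using fin f by (subst Sum_any.distrib) (auto simp: Sum_any_single[of k])
    ultimately have "?P (scale c x + y) ?g"
      using k f by (auto intro: subspace_add subspace_scale subspace_grade)
    then show ?case by (rule exI[of _ ?g])
  qed
  then show ?thesis using that by blast
qed

text \<open>Components are unique, and each degree \<open>k\<close> lies below \<open>s + n\<close>
  for large \<open>n\<close>, so every component is 0.\<close>

lemma Inter_grade_ge:
  assumes "\<And>n. n \<ge> 2 \<Longrightarrow> v \<in> grade_ge (s + n)"
  shows "v = 0"
proof -
  let ?D = "\<lambda>f. (\<forall>n. f n \<in> grade n) \<and> finite {n. f n \<noteq> 0} \<and> v = Sum_any f"
  obtain f where f: "?D f" using direct_sum by blast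
  have "f k = 0" for k
  proof -
    \<comment> \<open>The maximum is an admissible \<open>n\<close> with
      \<open>k < s + n\<close>.\<close>
    have "v \<in> grade_ge (s + max 2 (k - s + 1))" by (rule assms) simp
    then obtain g where "?D g" and "\<And>n. n < s + max 2 (k - s + 1) \<Longrightarrow> g n = 0"
      using grade_ge_decomposition by metis
    moreover from \<open>?D g\<close> f have "g = f" using direct_sum by blast
    ultimately show ?thesis by auto
  qed
  with f show ?thesis by simp
qed

lemma grade_ge_eq_UNIV:
  assumes "\<And>n. n < t \<Longrightarrow> grade n = {0}"
  shows "grade_ge t = UNIV"
proof -
  have "v \<in> grade_ge t" for v
  proof -
    obtain f where f: "\<And>n. f n \<in> grade n" and v: "v = Sum_any f" using direct_sum by blast
    have "f n \<in> grade_ge t" for n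
    proof (cases "n < t")
      case True
      then show ?thesis using assms f[of n] by (simp add: subspace_0 subspace_grade_ge)
    next
      case False
      then show ?thesis using f[of n] unfolding grade_ge_def by (intro span_base) auto
    qed
    then show ?thesis unfolding v by (intro subspace_Sum_any subspace_grade_ge)
  qed
  then show ?thesis by auto
qed

text \<open>Bilinearity carries \<open>mode_grade\<close> from homogeneous vectors to spans, one
  argument at a time.\<close>

lemma mode_grade_ge:
  assumes "u \<in> grade_ge k" "v \<in> grade_ge n"
  shows "mode u m v \<in> grade_ge (n + k - m - 1)"
proof -
  let ?S = "grade_ge (n + k - m - 1)"
  have "mode a m b \<in> ?S" if "a \<in> grade p" "b \<in> grade q" "p \<ge> k" "q \<ge> n" for a b p q
    unfolding grade_ge_def using that mode_grade[of a p b q m]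
    by (intro span_base UN_I[of "q + p - m - 1"]) auto
  then have "grade_ge n \<subseteq> {v. mode a m v \<in> ?S}" if "a \<in> grade p" "p \<ge> k" for a p
    using that unfolding grade_ge_def[of n]
    by (intro span_minimal subspace_mode_right subspace_grade_ge) auto
  then have "grade_ge k \<subseteq> {u. mode u m v \<in> ?S}"
    using assms(2) unfolding grade_ge_def[of k]
    by (intro span_minimal subspace_mode_left subspace_grade_ge) auto
  with assms(1) show ?thesis by auto
qed

lemma C_space_subset_grade_ge:
  assumes "\<And>n. n < t \<Longrightarrow> grade n = {0}"
  shows "C_space n \<subseteq> grade_ge (2 * t + n - 1)"
proof (rule C_space_subset[OF subspace_grade_ge])
  fix u v
  show "mode u (-n) v \<in> grade_ge (2 * t + n - 1)"
    using mode_grade_ge[of u t v t "-n"] grade_ge_eq_UNIV[OF assms] by simp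
qed

end

text \<open>The condition \<open>m \<ge> 1\<close> is there for \<open>n = 2\<close>: the other
  bound is then 0, and \<open>E_space 0\<close> is all of V because vac_(-1) v = v, so
  \<open>m = 0\<close> would fail, for instance, for \<open>t = 0\<close> and V nonzero.\<close>

theorem proposition3p9:
  fixes scale :: "complex \<Rightarrow> 'v::ab_group_add \<Rightarrow> 'v"
    and mode :: "'v \<Rightarrow> int \<Rightarrow> 'v \<Rightarrow> 'v"
    and vac :: 'v
    and grade :: "int \<Rightarrow> 'v set"
    and t :: int
  assumes "graded_vertex_algebra scale mode vac grade"
    and "\<And>n. n < t \<Longrightarrow> grade n = {0}"
  shows "(\<forall>n\<ge>2. vertex_algebra.C_space scale mode n
              \<subseteq> graded_vertex_algebra.grade_ge scale grade (2 * t + n - 1))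
    \<and> (\<forall>n\<ge>2. \<forall>m. m \<ge> 1 \<and> m \<ge> (n - 2) * 2 ^ nat (n - 2) \<longrightarrow>
            vertex_algebra.E_space scale mode m
              \<subseteq> graded_vertex_algebra.grade_ge scale grade (2 * t + n - 1))
    \<and> (\<Inter>n\<in>{0..}. vertex_algebra.E_space scale mode n)
        = (\<Inter>n\<in>{2..}. vertex_algebra.C_space scale mode n)
    \<and> (\<Inter>n\<in>{2..}. vertex_algebra.C_space scale mode n) = {0}"
proof -
  interpret graded_vertex_algebra scale mode vac grade by fact
  note C_sub = C_space_subset_grade_ge[of t, OF assms(2)]
  have "(\<Inter>n\<in>{2..}. C_space n) \<subseteq> {0}"
    using C_sub Inter_grade_ge[of _ "2 * t - 1"] by (fastforce simp: algebra_simps)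
  then have C_zero: "(\<Inter>n\<in>{2..}. C_space n) = {0}"
    using C_space_zero by auto
  have "(\<Inter>n\<in>{0..}. E_space n) \<subseteq> (\<Inter>n\<in>{2..}. C_space n)"
  proof (rule INT_greatest)
    fix n :: int assume "n \<in> {2..}"
    \<comment> \<open>The \<open>max 1\<close> covers \<open>n = 2\<close>, where the threshold is
      0.\<close>
    then have "E_space (max 1 ((n - 2) * 2 ^ nat (n - 2))) \<subseteq> C_space n"
      by (intro E_space_subset_C_space) auto
    then show "(\<Inter>n\<in>{0..}. E_space n) \<subseteq> C_space n" by fastforce
  qed
  moreover have "0 \<in> E_space n" for n
    unfolding E_space_def by (rule span_zero)
  ultimately have "(\<Inter>n\<in>{0..}. E_space n) = {0}" using C_zero by auto
  moreover have "E_space m \<subseteq> grade_ge (2 * t + n - 1)"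
    if "n \<ge> 2" "m \<ge> 1" "m \<ge> (n - 2) * 2 ^ nat (n - 2)" for m n
    using E_space_subset_C_space[OF that] C_sub by (rule subset_trans)
  ultimately show ?thesis using C_zero C_sub by auto
qed

end
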